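(* For an integer $d\ge2$ let $\mathcal P_d$ be the property of containing a copy of $K_d$. Let $f:\mathbb N\to\mathbb R$ be a positive function tending to zero (arbitrarily slowly) as $n\to\infty$. Then w.h.p. $\tau(\mathcal P_d,n)\ge f(n)\cdot n^{(d-2)/(d-1)}$; that is, for every strategy of Builder in the online semi-random process, with probability $1-o(1)$ his multigraph after $f(n)\cdot n^{(d-2)/(d-1)}$ rounds contains no copy of $K_d$.
   Context: Semi-random multigraph process (online version): fix $n$ and start with the empty multigraph on $[n]$. In each round $t$, a vertex $v_t$ is chosen uniformly at random from $[n]$, independently of all previous rounds; Builder then chooses $u_t\in[n]$ (possibly $u_t=v_t$), which may depend only on $v_1,\dots,v_t$, his earlier choices and his own randomness, and adds the edge $u_tv_t$ (loops and multiple edges allowed). *)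

theory Defs
  imports "HOL-Probability.Probability" "HOL-Library.Uprod" "HOL-Library.Multiset"
begin

text \<open>
  A multigraph on the vertex set \<open>{1..n}\<close> is given by the multiset of its edges; an edge is an
  unordered pair of vertices, and a loop at \<open>x\<close> is \<open>Upair x x\<close>.
\<close>

type_synonym multigraph = "nat uprod multiset"

text \<open>
  A strategy maps Builder's own randomness, the offered vertices \<open>[v\<^sub>1, \<dots>, v\<^sub>t]\<close> and his earlier
  choices \<open>[u\<^sub>1, \<dots>, u\<^sub>t\<^sub>-\<^sub>1]\<close> to his choice \<open>u\<^sub>t\<close>. The randomness is a single random element, drawn
  independently of the offered vertices from an arbitrary probability space; fresh coin tosses
  for every round are a special case.
\<close>

type_synonym 'r strategy = "'r \<Rightarrow> nat list \<Rightarrow> nat list \<Rightarrow> nat"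

definition builder_strategy :: "nat \<Rightarrow> 'r measure \<Rightarrow> 'r strategy \<Rightarrow> bool" where
  "builder_strategy n R S \<longleftrightarrow>
     prob_space R \<and>
     (\<forall>vs\<in>lists {1..n}. \<forall>us\<in>lists {1..n}. length vs = Suc (length us) \<longrightarrow>
        (\<lambda>r. S r vs us) \<in> R \<rightarrow>\<^sub>M count_space {1..n})"

text \<open>
  Outcomes are pairs of Builder's randomness and the infinite sequence of offered vertices, where
  \<open>v i\<close> is the vertex offered in round \<open>i + 1\<close>.
\<close>

definition semi_random_space :: "nat \<Rightarrow> 'r measure \<Rightarrow> ('r \<times> (nat \<Rightarrow> nat)) measure" where
  "semi_random_space n R = R \<Otimes>\<^sub>M (\<Pi>\<^sub>M i\<in>UNIV. uniform_count_measure {1..n})"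

primrec builder_choices :: "'r strategy \<Rightarrow> 'r \<times> (nat \<Rightarrow> nat) \<Rightarrow> nat \<Rightarrow> nat list" where
  "builder_choices S \<omega> 0 = []"
| "builder_choices S \<omega> (Suc t) =
     builder_choices S \<omega> t @
       [S (fst \<omega>) (map (snd \<omega>) [0..<Suc t]) (builder_choices S \<omega> t)]"

definition builder_graph :: "'r strategy \<Rightarrow> 'r \<times> (nat \<Rightarrow> nat) \<Rightarrow> nat \<Rightarrow> multigraph" where
  "builder_graph S \<omega> t = mset (map2 Upair (builder_choices S \<omega> t) (map (snd \<omega>) [0..<t]))"

definition contains_complete :: "nat \<Rightarrow> nat \<Rightarrow> multigraph \<Rightarrow> bool" where
  "contains_complete d n G \<longleftrightarrow>
     (\<exists>W\<subseteq>{1..n}. card W = d \<and> (\<forall>x\<in>W. \<forall>y\<in>W. x \<noteq> y \<longrightarrow> Upair x y \<in># G))"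

text \<open>The first round after which the property holds, and \<open>\<infinity>\<close> if it never does.\<close>

definition hitting_time ::
    "(nat \<Rightarrow> multigraph \<Rightarrow> bool) \<Rightarrow> nat \<Rightarrow> 'r strategy \<Rightarrow> 'r \<times> (nat \<Rightarrow> nat) \<Rightarrow> enat" where
  "hitting_time P n S \<omega> = (INF t\<in>{t. P n (builder_graph S \<omega> t)}. enat t)"

end

theory Submission
  imports Defs
begin

text \<open>
  Count the vertex sets of \<open>k\<close>-cliques. A \<open>(k + 1)\<close>-clique created in a round with offered vertex
  \<open>v\<close> and choice \<open>u\<close> loses its new edge when \<open>u\<close> is removed, so it comes from an older \<open>k\<close>-clique
  containing \<open>v\<close>. Averaging over \<open>v\<close>, the expected number of new \<open>(k + 1)\<close>-cliques is at most \<open>k/n\<close>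
  times the expected number of \<open>k\<close>-cliques, whatever Builder does. Starting from \<open>n\<close> cliques of
  size 1, after \<open>t\<close> rounds the expected number of \<open>d\<close>-cliques is at most
  \<open>(d - 1)! t\<^sup>d\<^sup>-\<^sup>1 / n\<^sup>d\<^sup>-\<^sup>2\<close>, which is at most \<open>(d - 1)! f(n)\<^sup>d\<^sup>-\<^sup>1\<close> in the range considered.
\<close>

section \<open>Cliques of a multigraph and the effect of one new edge\<close>

text \<open>Cliques are vertex sets, so parallel edges do not inflate the count, loops are ignored,
  and every singleton of \<open>{1..n}\<close> is a clique of size 1.\<close>

definition cliques :: "nat \<Rightarrow> multigraph \<Rightarrow> nat \<Rightarrow> nat set set" where
  "cliques n G k = {W. W \<subseteq> {1..n} \<and> card W = k \<and> (\<forall>x\<in>W. \<forall>y\<in>W. x \<noteq> y \<longrightarrow> Upair x y \<in># G)}"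

lemma finite_cliques [simp]: "finite (cliques n G k)"
  by (rule finite_subset[of _ "Pow {1..n}"]) (auto simp: cliques_def)

lemma contains_complete_iff_cliques: "contains_complete d n G \<longleftrightarrow> cliques n G d \<noteq> {}"
  by (auto simp: contains_complete_def cliques_def)

lemma cliques_empty_graph: "cliques n {#} (Suc (Suc k)) = {}"
proof -
  have "\<exists>x\<in>W. \<exists>y\<in>W. x \<noteq> y" if "card W = Suc (Suc k)" for W :: "nat set"
  proof -
    obtain x y B where "W = insert x (insert y B)" "x \<noteq> y"
      using \<open>card W = Suc (Suc k)\<close> by (auto simp: card_Suc_eq)
    then show ?thesis
      by blast
  qed
  then show ?thesis
    by (fastforce simp: cliques_def)
qed

text \<open>A new clique must use the new edge, so it contains both ends and these are distinct (a
  loop creates nothing). Deleting \<open>u\<close> leaves an old clique that still contains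
  \<open>v\<close>.\<close>

lemma cliques_add_edge:
  "cliques n (add_mset (Upair u v) G) (Suc k) \<subseteq>
     cliques n G (Suc k) \<union> insert u ` {W \<in> cliques n G k. v \<in> W}"
proof
  fix W assume W: "W \<in> cliques n (add_mset (Upair u v) G) (Suc k)"
  show "W \<in> cliques n G (Suc k) \<union> insert u ` {W \<in> cliques n G k. v \<in> W}"
  proof (cases "W \<in> cliques n G (Suc k)")
    case False
    then have "\<exists>x\<in>W. \<exists>y\<in>W. x \<noteq> y \<and> Upair x y = Upair u v"
      using W by (simp add: cliques_def) blast
    then have uv: "u \<in> W" "v \<in> W" "u \<noteq> v"
      by auto
    have "finite W"
      using W by (auto simp: cliques_def intro: finite_subset)
    \<comment> \<open>Pairs inside \<open>W - {u}\<close> avoid the new edge, so they were already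
      joined in \<open>G\<close>.\<close>
    then have "W - {u} \<in> {W \<in> cliques n G k. v \<in> W}"
      using W uv by (auto simp: cliques_def)
    moreover have "W = insert u (W - {u})"
      using uv by auto
    ultimately show ?thesis
      by blast
  qed simp
qed

text \<open>Double counting of the pairs \<open>(v, W)\<close> with
  \<open>v \<in> W\<close>.\<close>

lemma sum_cliques_containing:
  "(\<Sum>v=1..n. card {W \<in> cliques n G k. v \<in> W}) = k * card (cliques n G k)"
proof -
  have "(\<Sum>v=1..n. card {W \<in> cliques n G k. v \<in> W}) =
        (\<Sum>v=1..n. \<Sum>W\<in>cliques n G k. if v \<in> W then 1 else 0)"
    by (simp add: sum.If_cases Int_def conj_commute)
  also have "\<dots> = (\<Sum>W\<in>cliques n G k. \<Sum>v=1..n. if v \<in> W then 1 else 0)"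
    by (rule sum.swap)
  also have "\<dots> = (\<Sum>W\<in>cliques n G k. k)"
  proof (rule sum.cong)
    fix W assume "W \<in> cliques n G k"
    then have "{1..n} \<inter> {v. v \<in> W} = W" "card W = k"
      by (auto simp: cliques_def)
    then show "(\<Sum>v=1..n. if v \<in> W then 1 else 0) = k"
      by (simp add: sum.If_cases)
  qed simp
  finally show ?thesis
    by simp
qed

section \<open>Builder's process along a sequence of offers\<close>

lemma length_builder_choices [simp]: "length (builder_choices S \<omega> t) = t"
  by (induction t) auto

text \<open>Only the first \<open>t\<close> offers matter up to time \<open>t\<close>. This allows
  an infinite sequence to be replaced by \<open>(!) vs\<close> for a list \<open>vs\<close> of
  length \<open>t\<close>, whatever \<open>(!)\<close> returns beyond the end of the list.\<close>

lemma builder_choices_cong: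
  assumes "fst \<omega> = fst \<omega>'" "\<And>i. i < t \<Longrightarrow> snd \<omega> i = snd \<omega>' i"
  shows "builder_choices S \<omega> t = builder_choices S \<omega>' t"
  using assms
proof (induction t)
  case (Suc t)
  then have "map (snd \<omega>) [0..<Suc t] = map (snd \<omega>') [0..<Suc t]"
    by (intro map_cong) auto
  with Suc show ?case
    by (simp only: builder_choices.simps less_SucI)
qed simp

lemma builder_graph_cong:
  assumes "fst \<omega> = fst \<omega>'" "\<And>i. i < t \<Longrightarrow> snd \<omega> i = snd \<omega>' i"
  shows "builder_graph S \<omega> t = builder_graph S \<omega>' t"
proof -
  have "map (snd \<omega>) [0..<t] = map (snd \<omega>') [0..<t]"
    using assms by (intro map_cong) auto
  moreover have "builder_choices S \<omega> t = builder_choices S \<omega>' t"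
    using assms by (rule builder_choices_cong)
  ultimately show ?thesis
    by (simp only: builder_graph_def)
qed

lemma builder_graph_Suc:
  "builder_graph S \<omega> (Suc t) =
     add_mset (Upair (S (fst \<omega>) (map (snd \<omega>) [0..<Suc t]) (builder_choices S \<omega> t)) (snd \<omega> t))
       (builder_graph S \<omega> t)"
  by (simp add: builder_graph_def)

lemma builder_graph_mono: "s \<le> t \<Longrightarrow> builder_graph S \<omega> s \<subseteq># builder_graph S \<omega> t"
proof (induction t rule: dec_induct)
  case (step t)
  then show ?case
    by (metis builder_graph_Suc subset_mset.order_trans mset_subset_eq_add_right add_mset_add_single
        mset_subset_eq_add_left)
qed simp

lemma contains_complete_mono:
  "contains_complete d n G \<Longrightarrow> G \<subseteq># H \<Longrightarrow> contains_complete d n H"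
  unfolding contains_complete_def by (blast dest: mset_subset_eqD)

section \<open>Averaging over all finite offer sequences\<close>

definition offers :: "nat \<Rightarrow> nat \<Rightarrow> nat list set" where
  "offers n t = {vs. set vs \<subseteq> {1..n} \<and> length vs = t}"

lemma finite_offers [simp]: "finite (offers n t)"
  by (simp add: offers_def finite_lists_length_eq)

lemma card_offers: "card (offers n t) = n ^ t"
  by (simp add: offers_def card_lists_length_eq)

text \<open>Splits off the last offer, so that the inner sum averages over the next vertex with the
  history fixed.\<close>

lemma sum_offers_Suc:
  "(\<Sum>vs\<in>offers n (Suc t). h vs) = (\<Sum>vs\<in>offers n t. \<Sum>v=1..n. h (vs @ [v]))"
proof -
  have "bij_betw (\<lambda>(vs, v). vs @ [v]) (offers n t \<times> {1..n}) (offers n (Suc t))"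
    unfolding bij_betw_def
  proof
    show "inj_on (\<lambda>(vs, v). vs @ [v]) (offers n t \<times> {1..n})"
      by (auto simp: inj_on_def)
    show "(\<lambda>(vs, v). vs @ [v]) ` (offers n t \<times> {1..n}) = offers n (Suc t)"
    proof
      show "offers n (Suc t) \<subseteq> (\<lambda>(vs, v). vs @ [v]) ` (offers n t \<times> {1..n})"
      proof
        fix ws assume ws: "ws \<in> offers n (Suc t)"
        then obtain vs v where "ws = vs @ [v]"
          by (cases ws rule: rev_cases) (auto simp: offers_def)
        with ws show "ws \<in> (\<lambda>(vs, v). vs @ [v]) ` (offers n t \<times> {1..n})"
          by (auto simp: offers_def image_iff)
      qed
    qed (auto simp: offers_def)
  qed
  then have "(\<Sum>vs\<in>offers n (Suc t). h vs) = (\<Sum>(vs, v)\<in>offers n t \<times> {1..n}. h (vs @ [v]))"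
    by (simp add: sum.reindex_bij_betw[symmetric] case_prod_unfold)
  then show ?thesis
    by (simp add: sum.cartesian_product)
qed

text \<open>For fixed randomness \<open>r\<close> this is \<open>n ^ t\<close> times the expected
  number of \<open>k\<close>-cliques after \<open>t\<close> rounds; leaving out the normalisation
  keeps the counting in the natural numbers.\<close>

definition clique_total :: "'r strategy \<Rightarrow> 'r \<Rightarrow> nat \<Rightarrow> nat \<Rightarrow> nat \<Rightarrow> nat" where
  "clique_total S r n t k = (\<Sum>vs\<in>offers n t. card (cliques n (builder_graph S (r, (!) vs) t) k))"

text \<open>With the history fixed, the number of new cliques is bounded in terms of the offer
  \<open>v\<close> alone, and summing over \<open>v\<close> is the double count
  \<open>sum_cliques_containing\<close>.\<close>

lemma clique_total_Suc:
  "clique_total S r n (Suc t) (Suc k) \<le> n * clique_total S r n t (Suc k) + k * clique_total S r n t k"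
proof -
  let ?G = "\<lambda>vs. builder_graph S (r, (!) vs) t"
  have step: "card (cliques n (builder_graph S (r, (!) (vs @ [v])) (Suc t)) (Suc k)) \<le>
      card (cliques n (?G vs) (Suc k)) + card {W \<in> cliques n (?G vs) k. v \<in> W}"
    if "vs \<in> offers n t" for vs v
  proof -
    have "length vs = t"
      using that by (simp add: offers_def)
    moreover from this have "builder_graph S (r, (!) (vs @ [v])) t = ?G vs"
      by (intro builder_graph_cong) (auto simp: nth_append)
    moreover from \<open>length vs = t\<close> have "snd (r, (!) (vs @ [v])) t = v"
      by (simp add: nth_append)
    \<comment> \<open>Here \<open>u\<close> may depend on \<open>v\<close> and the whole history;
      the bound holds for every value of it.\<close>
    ultimately obtain u where
      "builder_graph S (r, (!) (vs @ [v])) (Suc t) = add_mset (Upair u v) (?G vs)"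
      unfolding builder_graph_Suc by metis
    then have "card (cliques n (builder_graph S (r, (!) (vs @ [v])) (Suc t)) (Suc k)) \<le>
        card (cliques n (?G vs) (Suc k) \<union> insert u ` {W \<in> cliques n (?G vs) k. v \<in> W})"
      by (simp add: cliques_add_edge card_mono)
    also have "\<dots> \<le> card (cliques n (?G vs) (Suc k)) +
        card (insert u ` {W \<in> cliques n (?G vs) k. v \<in> W})"
      by (rule card_Un_le)
    also have "\<dots> \<le> card (cliques n (?G vs) (Suc k)) + card {W \<in> cliques n (?G vs) k. v \<in> W}"
      by (simp add: card_image_le)
    finally show ?thesis .
  qed
  have "clique_total S r n (Suc t) (Suc k) \<le> (\<Sum>vs\<in>offers n t. \<Sum>v=1..n.
      card (cliques n (?G vs) (Suc k)) + card {W \<in> cliques n (?G vs) k. v \<in> W})"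
    unfolding clique_total_def sum_offers_Suc by (intro sum_mono step)
  also have "\<dots> = (\<Sum>vs\<in>offers n t.
      n * card (cliques n (?G vs) (Suc k)) + k * card (cliques n (?G vs) k))"
    by (simp add: sum.distrib sum_cliques_containing flip: One_nat_def)
  also have "\<dots> = n * clique_total S r n t (Suc k) + k * clique_total S r n t k"
    by (simp add: clique_total_def sum.distrib sum_distrib_left)
  finally show ?thesis .
qed

lemma clique_total_1: "clique_total S r n t (Suc 0) = n * n ^ t"
proof -
  have "cliques n G (Suc 0) = (\<lambda>x. {x}) ` {1..n}" for G
    by (auto simp: cliques_def card_Suc_eq)
  then have "card (cliques n G (Suc 0)) = n" for G
    by (simp add: card_image)
  then show ?thesis
    by (simp add: clique_total_def card_offers)
qed

text \<open>Stated without division, so that no truncated exponent \<open>k - 1\<close> occurs.\<close>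

lemma clique_total_bound:
  "clique_total S r n t (Suc k) * n ^ k \<le> fact k * t ^ k * n * n ^ t"
proof (induction t arbitrary: k)
  case 0
  show ?case
  proof (cases k)
    case 0
    then show ?thesis
      by (simp add: clique_total_1)
  next
    case (Suc j)
    have "builder_graph S (r, (!) vs) 0 = {#}" for vs
      by (simp add: builder_graph_def)
    with Suc show ?thesis
      by (simp add: clique_total_def cliques_empty_graph)
  qed
next
  case (Suc t)
  show ?case
  proof (cases k)
    case 0
    then show ?thesis
      by (simp add: clique_total_1)
  next
    case k: (Suc j)
    have "clique_total S r n (Suc t) (Suc k) * n ^ k \<le>
        (n * clique_total S r n t (Suc k) + k * clique_total S r n t k) * n ^ k"
      by (intro mult_right_mono clique_total_Suc) simp
    \<comment> \<open>The powers of \<open>n\<close> are regrouped to match the induction hypothesis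
      for both \<open>k\<close> and \<open>j\<close>.\<close>
    also have "\<dots> = n * (clique_total S r n t (Suc k) * n ^ k) +
        k * n * (clique_total S r n t (Suc j) * n ^ j)"
      by (simp add: k algebra_simps)
    also have "\<dots> \<le> n * (fact k * t ^ k * n * n ^ t) + k * n * (fact j * t ^ j * n * n ^ t)"
      by (intro add_mono mult_left_mono Suc.IH) simp_all
    \<comment> \<open>The terms merge because \<open>k * fact j = fact k\<close> and
      \<open>t ^ k = t ^ j * t\<close>; afterwards \<open>t ^ j\<close> is relaxed to
      \<open>Suc t ^ j\<close>.\<close>
    also have "\<dots> = fact k * (t ^ j * Suc t) * n * n ^ Suc t"
      by (simp add: k algebra_simps)
    also have "\<dots> \<le> fact k * Suc t ^ k * n * n ^ Suc t"
      unfolding k power_Suc2 by (intro mult_mono power_mono) simp_all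
    finally show ?thesis .
  qed
qed

text \<open>Markov's inequality in counting form: each bad sequence contributes at least one
  clique.\<close>

lemma card_bad_offers:
  "card {vs \<in> offers n t. contains_complete k n (builder_graph S (r, (!) vs) t)} \<le> clique_total S r n t k"
proof -
  have "card {vs \<in> offers n t. contains_complete k n (builder_graph S (r, (!) vs) t)} =
      (\<Sum>vs\<in>offers n t. if contains_complete k n (builder_graph S (r, (!) vs) t) then 1 else 0)"
    by (simp add: sum.If_cases Int_def)
  also have "\<dots> \<le> clique_total S r n t k"
    unfolding clique_total_def
    by (intro sum_mono) (auto simp: contains_complete_iff_cliques Suc_le_eq card_gt_0_iff)
  finally show ?thesis .
qed

section \<open>Distribution of the offered vertices\<close>

abbreviation offer_space :: "nat \<Rightarrow> (nat \<Rightarrow> nat) measure" where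
  "offer_space n \<equiv> \<Pi>\<^sub>M i\<in>UNIV. uniform_count_measure {1..n}"

lemma prob_space_offer_space: "n \<ge> 1 \<Longrightarrow> prob_space (offer_space n)"
  by (intro prob_space_PiM prob_space_uniform_count_measure) auto

lemma space_offer_space: "v \<in> space (offer_space n) \<Longrightarrow> v i \<in> {1..n}"
  by (auto simp: space_PiM space_uniform_count_measure)

text \<open>Brings the event into the form of a rectangle with one-point sides, whose product
  measure is a finite product.\<close>

lemma cylinder_eq_prod_emb:
  assumes "vs \<in> offers n t"
  shows "{v \<in> space (offer_space n). map v [0..<t] = vs} =
    prod_emb UNIV (\<lambda>_. uniform_count_measure {1..n}) {..<t} (\<Pi>\<^sub>E i\<in>{..<t}. {vs ! i})"
  using assms
  by (auto simp: prod_emb_def space_PiM offers_def list_eq_iff_nth_eq PiE_iff extensional_def)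

lemma measure_cylinder:
  assumes "n \<ge> 1" "vs \<in> offers n t"
  shows "{v \<in> space (offer_space n). map v [0..<t] = vs} \<in> sets (offer_space n)"
    and "measure (offer_space n) {v \<in> space (offer_space n). map v [0..<t] = vs} = 1 / real n ^ t"
proof -
  interpret product_prob_space "\<lambda>_::nat. uniform_count_measure {1..n}" UNIV
    using assms(1) by (intro product_prob_spaceI prob_space_uniform_count_measure) auto
  have vs: "vs ! i \<in> {1..n}" if "i < t" for i
    using assms(2) that by (auto simp: offers_def dest!: nth_mem)
  then have sets: "{vs ! i} \<in> sets (uniform_count_measure {1..n})" if "i < t" for i
    using that by (auto simp: sets_uniform_count_measure)
  show "{v \<in> space (offer_space n). map v [0..<t] = vs} \<in> sets (offer_space n)"
    unfolding cylinder_eq_prod_emb[OF assms(2)] using sets by (intro sets_PiM_I) auto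
  have "measure (offer_space n) {v \<in> space (offer_space n). map v [0..<t] = vs} =
      (\<Prod>i<t. measure (uniform_count_measure {1..n}) {vs ! i})"
    unfolding cylinder_eq_prod_emb[OF assms(2)] using sets by (intro measure_PiM_emb) auto
  also have "\<dots> = (\<Prod>i<t. 1 / real n)"
    using vs by (intro prod.cong) (auto simp: measure_uniform_count_measure)
  finally show "measure (offer_space n) {v \<in> space (offer_space n). map v [0..<t] = vs} = 1 / real n ^ t"
    by (simp add: power_one_over)
qed

text \<open>An event decided by the first \<open>t\<close> offers is a finite disjoint union of
  cylinders of equal measure, so its probability is a proportion of lists.\<close>

lemma measure_offer_space_prefix:
  assumes "n \<ge> 1"
  shows "measure (offer_space n) {v \<in> space (offer_space n). Q (map v [0..<t])} =
    card {vs \<in> offers n t. Q vs} / real n ^ t"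
proof -
  interpret prob_space "offer_space n"
    using assms by (rule prob_space_offer_space)
  let ?C = "\<lambda>vs. {v \<in> space (offer_space n). map v [0..<t] = vs}"
  have "{v \<in> space (offer_space n). Q (map v [0..<t])} = (\<Union>vs\<in>{vs \<in> offers n t. Q vs}. ?C vs)"
    using space_offer_space by (fastforce simp: offers_def)
  also have "prob \<dots> = (\<Sum>vs\<in>{vs \<in> offers n t. Q vs}. prob (?C vs))"
    using measure_cylinder(1)[OF assms]
    by (intro finite_measure_finite_Union) (auto simp: disjoint_family_on_def)
  also have "\<dots> = (\<Sum>vs\<in>{vs \<in> offers n t. Q vs}. 1 / real n ^ t)"
    by (intro sum.cong refl measure_cylinder(2)[OF assms]) auto
  finally show ?thesis
    by simp
qed

section \<open>Measurability of events about Builder's multigraph\<close>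

lemma space_semi_random_spaceD:
  "\<omega> \<in> space (semi_random_space n R) \<Longrightarrow> fst \<omega> \<in> space R \<and> snd \<omega> i \<in> {1..n}"
  using space_offer_space by (auto simp: semi_random_space_def space_pair_measure)

lemma builder_choices_in_lists:
  assumes S: "builder_strategy n R S" and \<omega>: "\<omega> \<in> space (semi_random_space n R)"
  shows "builder_choices S \<omega> t \<in> lists {1..n}"
proof (induction t)
  case (Suc t)
  have "map (snd \<omega>) [0..<Suc t] \<in> lists {1..n}"
    using space_semi_random_spaceD[OF \<omega>] by (auto simp del: upt_Suc)
  with Suc S have "(\<lambda>r. S r (map (snd \<omega>) [0..<Suc t]) (builder_choices S \<omega> t)) \<in>
      R \<rightarrow>\<^sub>M count_space {1..n}"
    by (simp add: builder_strategy_def del: upt_Suc)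
  then have "S (fst \<omega>) (map (snd \<omega>) [0..<Suc t]) (builder_choices S \<omega> t) \<in> {1..n}"
    using space_semi_random_spaceD[OF \<omega>] by (auto dest!: measurable_space simp del: upt_Suc)
  with Suc show ?case
    by (simp del: upt_Suc)
qed simp

text \<open>\<open>builder_strategy\<close> gives measurability in \<open>r\<close> only for fixed
  lists. Fixing the whole history makes each choice a function of \<open>r\<close> alone.\<close>

lemma sets_history:
  assumes S: "builder_strategy n R S" and "us \<in> lists {1..n}" "vs \<in> lists {1..n}"
  shows "{\<omega> \<in> space (semi_random_space n R).
      builder_choices S \<omega> t = us \<and> map (snd \<omega>) [0..<t] = vs} \<in> sets (semi_random_space n R)"
  using assms(2,3)
proof (induction t arbitrary: us vs)
  case 0
  then show ?case
    by auto
next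
  case (Suc t)
  let ?M = "semi_random_space n R"
  show ?case
  proof (cases "length us = Suc t \<and> length vs = Suc t")
    case True
    then obtain us' u vs' v where uv: "us = us' @ [u]" "vs = vs' @ [v]"
      by (metis append_butlast_last_id length_0_conv nat.distinct(1))
    have "(\<lambda>r. S r vs us') \<in> R \<rightarrow>\<^sub>M count_space {1..n}"
      using S Suc.prems True unfolding uv by (simp add: builder_strategy_def)
    then have [measurable]: "(\<lambda>\<omega>. S (fst \<omega>) vs us') \<in> ?M \<rightarrow>\<^sub>M count_space {1..n}"
      unfolding semi_random_space_def by (rule measurable_compose[OF measurable_fst])
    have "(\<lambda>\<omega>. snd \<omega> t) \<in> ?M \<rightarrow>\<^sub>M uniform_count_measure {1..n}"
      unfolding semi_random_space_def by measurable
    then have [measurable]: "(\<lambda>\<omega>. snd \<omega> t) \<in> ?M \<rightarrow>\<^sub>M count_space {1..n}"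
      by (simp add: measurable_def space_uniform_count_measure sets_uniform_count_measure)
    \<comment> \<open>On this event the actual history equals the constants \<open>us'\<close> and
      \<open>vs\<close>, which may therefore replace it in the argument of \<open>S\<close>.\<close>
    have "{\<omega> \<in> space ?M. builder_choices S \<omega> (Suc t) = us \<and> map (snd \<omega>) [0..<Suc t] = vs} =
        {\<omega> \<in> space ?M. builder_choices S \<omega> t = us' \<and> map (snd \<omega>) [0..<t] = vs'} \<inter>
        {\<omega> \<in> space ?M. S (fst \<omega>) vs us' = u} \<inter> {\<omega> \<in> space ?M. snd \<omega> t = v}"
      unfolding uv by auto
    moreover have "{\<omega> \<in> space ?M. builder_choices S \<omega> t = us' \<and> map (snd \<omega>) [0..<t] = vs'} \<in> sets ?M"
      using Suc.prems unfolding uv by (intro Suc.IH) auto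
    moreover have "{\<omega> \<in> space ?M. S (fst \<omega>) vs us' = u} \<in> sets ?M"
      by measurable
    moreover have "{\<omega> \<in> space ?M. snd \<omega> t = v} \<in> sets ?M"
      by measurable
    ultimately show ?thesis
      by auto
  next
    case False
    then have "{\<omega> \<in> space ?M. builder_choices S \<omega> (Suc t) = us \<and> map (snd \<omega>) [0..<Suc t] = vs} = {}"
      by (auto simp del: upt_Suc builder_choices.simps)
    then show ?thesis
      by (metis sets.empty_sets)
  qed
qed

text \<open>The multigraph is determined by the history, and only finitely many histories of length
  \<open>t\<close> exist. No condition on \<open>P\<close> is needed; \<open>offers n t\<close> also
  serves as the range of Builder's choices.\<close>

lemma sets_builder_graph:
  assumes S: "builder_strategy n R S"
  shows "{\<omega> \<in> space (semi_random_space n R). P (builder_graph S \<omega> t)} \<in> sets (semi_random_space n R)"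
proof -
  let ?M = "semi_random_space n R"
  let ?I = "{(us, vs). us \<in> offers n t \<and> vs \<in> offers n t \<and> P (mset (map2 Upair us vs))}"
  have "{\<omega> \<in> space ?M. P (builder_graph S \<omega> t)} = (\<Union>(us, vs)\<in>?I.
      {\<omega> \<in> space ?M. builder_choices S \<omega> t = us \<and> map (snd \<omega>) [0..<t] = vs})" (is "?L = ?U")
  proof
    show "?L \<subseteq> ?U"
    proof
      fix \<omega> assume \<omega>: "\<omega> \<in> ?L"
      then have "builder_choices S \<omega> t \<in> offers n t" "map (snd \<omega>) [0..<t] \<in> offers n t"
        using builder_choices_in_lists[OF S, of \<omega> t] space_semi_random_spaceD[of \<omega> n R]
        by (auto simp: offers_def)
      with \<omega> show "\<omega> \<in> ?U"
        by (auto simp: builder_graph_def)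
    qed
  qed (auto simp: builder_graph_def)
  moreover have "finite ?I"
    by (rule finite_subset[of _ "offers n t \<times> offers n t"]) auto
  then have "?U \<in> sets ?M"
    by (rule sets.finite_UN) (auto intro!: sets_history[OF S] simp: offers_def)
  ultimately show ?thesis
    by simp
qed

section \<open>Probability of a complete subgraph\<close>

text \<open>By Fubini it suffices to fix Builder's randomness \<open>r\<close>: the counting bound
  is uniform in \<open>r\<close>, so integrating over \<open>R\<close> preserves it.\<close>

lemma prob_contains_complete:
  assumes n: "n \<ge> 1" and S: "builder_strategy n R S"
  shows "\<P>(\<omega> in semi_random_space n R. contains_complete (Suc k) n (builder_graph S \<omega> t)) \<le>
    fact k * real t ^ k * real n / real n ^ k"
    (is "measure ?M ?A \<le> ?b")
proof -
  interpret R: prob_space R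
    using S by (simp add: builder_strategy_def)
  interpret V: prob_space "offer_space n"
    using n by (rule prob_space_offer_space)
  interpret P: pair_prob_space R "offer_space n" ..
  have slice: "emeasure (offer_space n) (Pair r -` ?A) \<le> ennreal ?b" if "r \<in> space R" for r
  proof -
    let ?Q = "\<lambda>vs. contains_complete (Suc k) n (builder_graph S (r, (!) vs) t)"
    have "builder_graph S (r, v) t = builder_graph S (r, (!) (map v [0..<t])) t" for v
      by (rule builder_graph_cong) auto
    then have "Pair r -` ?A = {v \<in> space (offer_space n). ?Q (map v [0..<t])}"
      using that by (auto simp: semi_random_space_def space_pair_measure)
    then have "measure (offer_space n) (Pair r -` ?A) = card {vs \<in> offers n t. ?Q vs} / real n ^ t"
      using measure_offer_space_prefix[OF n, of ?Q t] by simp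
    also have "\<dots> \<le> clique_total S r n t (Suc k) / real n ^ t"
      by (intro divide_right_mono) (simp_all add: card_bad_offers)
    also have "\<dots> \<le> ?b"
    proof -
      have "real (clique_total S r n t (Suc k) * n ^ k) \<le> real (fact k * t ^ k * n * n ^ t)"
        by (rule of_nat_mono[OF clique_total_bound])
      then show ?thesis
        using n by (simp add: field_simps)
    qed
    finally show ?thesis
      unfolding V.emeasure_eq_measure by (simp add: ennreal_leI)
  qed
  have "emeasure ?M ?A = (\<integral>\<^sup>+ r. emeasure (offer_space n) (Pair r -` ?A) \<partial>R)"
    using sets_builder_graph[OF S, of "contains_complete (Suc k) n" t]
    unfolding semi_random_space_def by (rule V.emeasure_pair_measure_alt)
  also have "\<dots> \<le> (\<integral>\<^sup>+ r. ennreal ?b \<partial>R)"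
    by (intro nn_integral_mono slice)
  also have "\<dots> = ennreal ?b"
    by (simp add: R.emeasure_space_1)
  finally have "ennreal (measure ?M ?A) \<le> ennreal ?b"
    unfolding semi_random_space_def P.emeasure_eq_measure .
  then show ?thesis
    by (subst (asm) ennreal_le_iff) simp_all
qed

lemma prob_space_semi_random_space:
  assumes "n \<ge> 1" "prob_space R"
  shows "prob_space (semi_random_space n R)"
  unfolding semi_random_space_def using assms prob_space_offer_space prob_space_pair by blast

section \<open>Hitting times\<close>

text \<open>Turns the event into a countable conjunction over rounds, from which its measurability
  follows.\<close>

lemma hitting_time_ge_iff:
  "ereal x \<le> ereal_of_enat (hitting_time P n S \<omega>) \<longleftrightarrow>
     (\<forall>t. P n (builder_graph S \<omega> t) \<longrightarrow> x \<le> real t)"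
proof
  assume *: "ereal x \<le> ereal_of_enat (hitting_time P n S \<omega>)"
  show "\<forall>t. P n (builder_graph S \<omega> t) \<longrightarrow> x \<le> real t"
  proof (intro allI impI)
    fix t assume "P n (builder_graph S \<omega> t)"
    then have "hitting_time P n S \<omega> \<le> enat t"
      unfolding hitting_time_def by (intro INF_lower) simp
    then have "ereal_of_enat (hitting_time P n S \<omega>) \<le> ereal_of_enat (enat t)"
      by (simp only: ereal_of_enat_le_iff)
    with * have "ereal x \<le> ereal (real t)"
      by (metis ereal_of_enat_simps(1) order_trans)
    then show "x \<le> real t"
      by simp
  qed
next
  assume *: "\<forall>t. P n (builder_graph S \<omega> t) \<longrightarrow> x \<le> real t"
  show "ereal x \<le> ereal_of_enat (hitting_time P n S \<omega>)"
  proof (cases "{t. P n (builder_graph S \<omega> t)} = {}")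
    \<comment> \<open>The infimum of the empty set is \<open>\<infinity>\<close>; otherwise it is
      attained, by well-ordering.\<close>
    case True
    then show ?thesis
      by (simp add: hitting_time_def top_enat_def)
  next
    case False
    then have "enat ` {t. P n (builder_graph S \<omega> t)} \<noteq> {}"
      by blast
    then have "hitting_time P n S \<omega> \<in> enat ` {t. P n (builder_graph S \<omega> t)}"
      unfolding hitting_time_def by (meson wellorder_InfI ex_in_conv)
    with * show ?thesis
      by auto
  qed
qed

text \<open>A clique never disappears, and a round \<open>t < x\<close> satisfies
  \<open>t \<le> nat \<lfloor>x\<rfloor>\<close>.\<close>

lemma not_contains_imp_hitting_time_ge:
  assumes "\<not> contains_complete d n (builder_graph S \<omega> (nat \<lfloor>x\<rfloor>))"
  shows "ereal x \<le> ereal_of_enat (hitting_time (contains_complete d) n S \<omega>)"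
  unfolding hitting_time_ge_iff
proof (intro allI impI, rule ccontr)
  fix t assume t: "contains_complete d n (builder_graph S \<omega> t)" and "\<not> x \<le> real t"
  then have "t \<le> nat \<lfloor>x\<rfloor>"
    by linarith
  with t assms show False
    using builder_graph_mono contains_complete_mono by blast
qed

section \<open>Passage to the limit\<close>

theorem theorem1p12:
  fixes d :: nat and f :: "nat \<Rightarrow> real"
    and R :: "nat \<Rightarrow> 'r measure" and S :: "nat \<Rightarrow> 'r strategy"
  assumes "d \<ge> 2"
    and "\<And>n. n \<ge> 1 \<Longrightarrow> f n > 0"
    and "f \<longlonglongrightarrow> 0"
    and "\<And>n. n \<ge> 1 \<Longrightarrow> builder_strategy n (R n) (S n)"
  shows "(\<lambda>n. \<P>(\<omega> in semi_random_space n (R n).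
             ereal_of_enat (hitting_time (contains_complete d) n (S n) \<omega>)
               \<ge> ereal (f n * real n powr ((real d - 2) / (real d - 1))))) \<longlonglongrightarrow> 1
       \<and> (\<lambda>n. \<P>(\<omega> in semi_random_space n (R n).
             \<not> contains_complete d n
                 (builder_graph (S n) \<omega>
                   (nat \<lfloor>f n * real n powr ((real d - 2) / (real d - 1))\<rfloor>)))) \<longlonglongrightarrow> 1"
proof -
  define x where "x n = f n * real n powr ((real d - 2) / (real d - 1))" for n
  let ?p = "\<lambda>n. \<P>(\<omega> in semi_random_space n (R n).
      ereal (x n) \<le> ereal_of_enat (hitting_time (contains_complete d) n (S n) \<omega>))"
  let ?q = "\<lambda>n. \<P>(\<omega> in semi_random_space n (R n).
      \<not> contains_complete d n (builder_graph (S n) \<omega> (nat \<lfloor>x n\<rfloor>)))"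
  define k where "k = d - 1"
  have k: "k \<ge> 1" "d = Suc k"
    using assms(1) by (auto simp: k_def)
  \<comment> \<open>Both probabilities are squeezed between this lower bound and 1; the hypotheses
    on \<open>f\<close> and \<open>S\<close> start at \<open>n = 1\<close>.\<close>
  have bounds: "1 - fact k * f n ^ k \<le> ?q n \<and> ?q n \<le> ?p n \<and> ?p n \<le> 1" if n: "n \<ge> 1" for n
  proof -
    let ?M = "semi_random_space n (R n)"
    have S: "builder_strategy n (R n) (S n)"
      using assms(4) n .
    interpret M: prob_space ?M
      using n S by (intro prob_space_semi_random_space) (auto simp: builder_strategy_def)
    have x_pos: "x n > 0"
      using assms(2)[OF n] n by (simp add: x_def)
    \<comment> \<open>The exponent is \<open>(k - 1) / k\<close>, so the \<open>k\<close>-th power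
      cancels exactly against \<open>real n / real n ^ k\<close>.\<close>
    have "x n ^ k = f n ^ k * real n powr (real k - 1)"
      using n k by (simp add: x_def power_mult_distrib powr_power)
    moreover have "real n powr (real k - 1) * real n / real n ^ k = 1"
      using n by (simp add: powr_diff powr_realpow)
    ultimately have x_pow: "x n ^ k * real n / real n ^ k = f n ^ k"
      by (metis mult.assoc mult.right_neutral times_divide_eq_right)
    have "M.prob {\<omega> \<in> space ?M. contains_complete d n (builder_graph (S n) \<omega> (nat \<lfloor>x n\<rfloor>))} \<le>
        fact k * real (nat \<lfloor>x n\<rfloor>) ^ k * real n / real n ^ k"
      unfolding k(2) by (rule prob_contains_complete[OF n S])
    also have "\<dots> \<le> fact k * x n ^ k * real n / real n ^ k"
      using x_pos by (intro divide_right_mono mult_right_mono mult_left_mono power_mono) auto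
    also have "\<dots> = fact k * f n ^ k"
      using x_pow by (metis mult.assoc times_divide_eq_right)
    finally have "1 - fact k * f n ^ k \<le> ?q n"
      by (subst M.prob_neg) (simp_all add: sets_builder_graph[OF S])
    moreover have "?q n \<le> ?p n"
    proof (rule M.finite_measure_mono)
      have "{\<omega> \<in> space ?M. \<forall>t. contains_complete d n (builder_graph (S n) \<omega> t) \<longrightarrow> x n \<le> real t} \<in> sets ?M"
        using sets_builder_graph[OF S] by (intro sets.sets_Collect_countable_All)
      then show "{\<omega> \<in> space ?M. ereal (x n) \<le>
          ereal_of_enat (hitting_time (contains_complete d) n (S n) \<omega>)} \<in> sets ?M"
        by (simp add: hitting_time_ge_iff)
    qed (auto intro: not_contains_imp_hitting_time_ge)
    ultimately show ?thesis
      by simp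
  qed
  have "(\<lambda>n. 1 - fact k * f n ^ k) \<longlonglongrightarrow> 1 - fact k * 0 ^ k"
    using assms(3) by (intro tendsto_intros)
  \<comment> \<open>\<open>0 ^ k\<close> vanishes because \<open>k \<ge> 1\<close>.\<close>
  then have lower: "(\<lambda>n. 1 - fact k * f n ^ k) \<longlonglongrightarrow> 1"
    using k by (simp add: power_0_left)
  have q: "?q \<longlonglongrightarrow> 1"
  proof (rule tendsto_sandwich[OF _ _ lower tendsto_const])
    show "eventually (\<lambda>n. 1 - fact k * f n ^ k \<le> ?q n) sequentially"
      using bounds by (intro eventually_sequentiallyI[of 1]) blast
    show "eventually (\<lambda>n. ?q n \<le> 1) sequentially"
      using bounds by (intro eventually_sequentiallyI[of 1]) (meson order_trans)
  qed
  moreover have "?p \<longlonglongrightarrow> 1"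
  proof (rule tendsto_sandwich[OF _ _ q tendsto_const])
    show "eventually (\<lambda>n. ?q n \<le> ?p n) sequentially"
      using bounds by (intro eventually_sequentiallyI[of 1]) blast
    show "eventually (\<lambda>n. ?p n \<le> 1) sequentially"
      using bounds by (intro eventually_sequentiallyI[of 1]) blast
  qed
  ultimately show ?thesis
    by (simp add: x_def)
qed

end
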